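(* Let $n\ge 1$, $p,q,r\ge 0$ be integers, $\rho\in(0,1)$, let $y_1,\dots,y_n\in(0,1)$ be a sample (realization of $Y_1,\dots,Y_n$) from a UWARMA$(p,q)$ model with link $g$ and associated covariates $\boldsymbol x_1,\dots,\boldsymbol x_n\in\mathbb R^r$, and let $\eta_t,\mu_t,r_t,A_t,\ell_t,\ell$ be the functions of the parameter $\boldsymbol\gamma=(\boldsymbol\nu',\lambda)'$, $\boldsymbol\nu=(\alpha,\boldsymbol\beta',\boldsymbol\phi',\boldsymbol\theta')'$, $\lambda>0$, defined in the context (with $Y_t=y_t$). Then: (1) For every $t\in\{1,\dots,n\}$, regarding $\ell_t$ as a function of $(\mu_t,\lambda)$, $$\frac{\partial \ell_t}{\partial\lambda}=\frac1\lambda+\big(1+A_t^\lambda\log(\rho)\big)\log(A_t),\qquad \frac{\partial \ell_t}{\partial\mu_t}=-\frac{\lambda\big(1+\log(\rho)A_t^\lambda\big)}{\mu_t\log(\mu_t)}.$$ (2) The derivatives of $\eta_t$ with respect to the components of $\boldsymbol\nu$ satisfy, for $t\in\{1,\dots,n\}$, $l\in\{1,\dots,r\}$, $k\in\{1,\dots,p\}$, $s\in\{1,\dots,q\}$, with the convention that the derivatives of $\eta_{t}$ are $0$ for $t\le 0$, $$\frac{\partial \eta_t}{\partial \alpha}=1-\sum_{j=1}^q\theta_j\frac{\partial\eta_{t-j}}{\partial\alpha},\qquad \frac{\partial \eta_t}{\partial \beta_l}=x_{tl}-\sum_{i=1}^p\phi_i x_{(t-i)l}-\sum_{j=1}^q\theta_j\frac{\partial\eta_{t-j}}{\partial\beta_l},$$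 $$\frac{\partial \eta_t}{\partial \phi_k}=g(y_{t-k})-\boldsymbol x_{t-k}'\boldsymbol\beta-\sum_{j=1}^q\theta_j\frac{\partial\eta_{t-j}}{\partial\phi_k},\qquad \frac{\partial \eta_t}{\partial \theta_s}=r_{t-s}-\sum_{i=1}^q\theta_i\frac{\partial\eta_{t-i}}{\partial\theta_s},$$ where $x_{tl}$ is the $l$-th component of $\boldsymbol x_t$. (3) Let $D_{\boldsymbol\nu}$ be the $n\times(p+q+r+1)$ matrix with $(i,j)$ entry $\partial\eta_i/\partial\nu_j$, let $T$ be the $n\times n$ diagonal matrix with $k$-th diagonal entry $1/g'(\mu_k)$, let $\boldsymbol h_1=(\partial\ell_1/\partial\mu_1,\dots,\partial\ell_n/\partial\mu_n)'$, $\boldsymbol h_2=(\partial\ell_1/\partial\lambda,\dots,\partial\ell_n/\partial\lambda)'$ with entries as in (1), and $\boldsymbol 1_n=(1,\dots,1)'\in\mathbb R^n$. Then the partial score vector $U(\boldsymbol\gamma)=\partial\ell(\boldsymbol\gamma)/\partial\boldsymbol\gamma$ is $$U(\boldsymbol\gamma)=\big(U_{\boldsymbol\nu}(\boldsymbol\gamma)',U_\lambda(\boldsymbol\gamma)\big)',\qquad U_{\boldsymbol\nu}(\boldsymbol\gamma)=D_{\boldsymbol\nu}'\,T\,\boldsymbol h_1,\qquad U_\lambda(\boldsymbol\gamma)=\boldsymbol 1_n'\boldsymbol h_2 .$$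
   Context: Unit-Weibull distribution: for $\rho,\mu\in(0,1)$ and $\lambda>0$, $\mathrm{UW}(\mu,\lambda;\rho)$ is the law on $(0,1)$ with density $$f_\rho(y;\mu,\lambda)=\frac\lambda y\Big[\frac{\log\rho}{\log\mu}\Big]\Big[\frac{\log y}{\log\mu}\Big]^{\lambda-1}\rho^{[\log y/\log\mu]^\lambda},\quad y\in(0,1).$$ UWARMA$(p,q)$ model: $Y_t$ takes values in $(0,1)$, $\boldsymbol x_t\in\mathbb R^r$ are covariates (random or deterministic, possibly time dependent; $\boldsymbol x_t=({\boldsymbol x_t^d}',{\boldsymbol x_{t-1}^s}')'$ with $\boldsymbol x^d_t$ non-random and $\boldsymbol x^s_{t-1}$ random), $\mathscr F_{t-1}=\sigma\{\boldsymbol x_t,Y_{t-1},\boldsymbol x_{t-1},Y_{t-2},\boldsymbol x_{t-2},\dots\}$, and $Y_t\mid\mathscr F_{t-1}\sim \mathrm{UW}(\mu_t,\lambda;\rho)$, where $$\eta_t:=g(\mu_t)=\alpha+\boldsymbol x_t'\boldsymbol\beta+\sum_{i=1}^p\phi_i\big[g(Y_{t-i})-\boldsymbol x_{t-i}'\boldsymbol\beta\big]+\sum_{j=1}^q\theta_j r_{t-j},\qquad r_t:=g(Y_t)-g(\mu_t).$$ The link $g:(0,1)\to\mathbb R$ is a twice differentiable strictly monotone bijection with $g'\neq 0$ everywhere. Here $\alpha\in\mathbb R$, $\boldsymbol\beta=(\beta_1,\dots,\beta_r)'$, $\boldsymbol\phi=(\phi_1,\dots,\phi_p)'$, $\boldsymbol\theta=(\theta_1,\dots,\theta_q)'$.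 The recursion is initialized at $t=1$ by setting, for $t\le 0$, $g(Y_t)=0$, $\boldsymbol x_t=\boldsymbol 0$ and $r_t=0$. Standing assumption of the model: the AR polynomial $1-\sum_i\phi_iz^i$ and the MA polynomial $1+\sum_j\theta_jz^j$ have no common roots, and the AR polynomial has no unit roots (roots of modulus one). Partial log-likelihood: with $A_t:=\log(Y_t)/\log(\mu_t)$, $$\ell_t(\boldsymbol\gamma)=\log(\lambda)-\log(Y_t)+\log\Big(\frac{\log\rho}{\log\mu_t}\Big)+(\lambda-1)\log(A_t)+\log(\rho)A_t^\lambda,\qquad \ell(\boldsymbol\gamma)=\sum_{t=1}^n\ell_t(\boldsymbol\gamma).$$ Primes on vectors and matrices denote transposes; $g'$ is the derivative of $g$. *)

theory Defs
  imports "HOL-Probability.Probability" "Jordan_Normal_Form.Matrix"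
begin

(* The vectors and matrices below are those of Jordan_Normal_Form, whose dimension is a number. *)
unbundle no vec_syntax

section \<open>Partial derivatives on real vectors\<close>

definition vec_upd :: "real vec \<Rightarrow> nat \<Rightarrow> real \<Rightarrow> real vec" where
  "vec_upd v i s = vec (dim_vec v) (\<lambda>j. if j = i then s else v $ j)"

definition partial_differentiable :: "(real vec \<Rightarrow> real) \<Rightarrow> real vec \<Rightarrow> nat \<Rightarrow> bool" where
  "partial_differentiable F v i \<longleftrightarrow> (\<lambda>s. F (vec_upd v i s)) differentiable (at (v $ i))"

definition partial_deriv :: "(real vec \<Rightarrow> real) \<Rightarrow> real vec \<Rightarrow> nat \<Rightarrow> real" where
  "partial_deriv F v i = deriv (\<lambda>s. F (vec_upd v i s)) (v $ i)"

definition gradient :: "(real vec \<Rightarrow> real) \<Rightarrow> real vec \<Rightarrow> real vec" where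
  "gradient F v = vec (dim_vec v) (partial_deriv F v)"


section \<open>The unit-Weibull distribution\<close>

definition uw_density :: "real \<Rightarrow> real \<Rightarrow> real \<Rightarrow> real \<Rightarrow> real" where
  "uw_density \<rho> \<mu> lam y =
     lam / y * (ln \<rho> / ln \<mu>) * (ln y / ln \<mu>) powr (lam - 1) * \<rho> powr ((ln y / ln \<mu>) powr lam)"

definition uw_law :: "real \<Rightarrow> real \<Rightarrow> real \<Rightarrow> real measure" where
  "uw_law \<rho> \<mu> lam =
     density lborel (\<lambda>y. ennreal (if 0 < y \<and> y < 1 then uw_density \<rho> \<mu> lam y else 0))"


section \<open>Link function and parameters\<close>

definition link_function :: "(real \<Rightarrow> real) \<Rightarrow> bool" where
  "link_function g \<longleftrightarrow>
     bij_betw g {0<..<1} UNIV \<and>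
     (strict_mono_on {0<..<1} g \<or> strict_antimono_on {0<..<1} g) \<and>
     (\<forall>u\<in>{0<..<1}. g differentiable (at u) \<and> deriv g differentiable (at u) \<and> deriv g u \<noteq> 0)"

definition inv_link :: "(real \<Rightarrow> real) \<Rightarrow> real \<Rightarrow> real" where
  "inv_link g = inv_into {0<..<1} g"

(* The parameter vector is nu = (alpha, beta_1..beta_r, phi_1..phi_p, theta_1..theta_q), stored
   from index 0, so that alpha, beta_l, phi_k, theta_s sit at the indices 0, l, r+k, r+p+s. *)

definition par_alpha :: "real vec \<Rightarrow> real" where
  "par_alpha \<nu> = \<nu> $ 0"

definition par_beta :: "nat \<Rightarrow> real vec \<Rightarrow> real vec" where
  "par_beta r \<nu> = vec r (\<lambda>l. \<nu> $ (l + 1))"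

definition par_phi :: "nat \<Rightarrow> real vec \<Rightarrow> nat \<Rightarrow> real" where
  "par_phi r \<nu> k = \<nu> $ (r + k)"

definition par_theta :: "nat \<Rightarrow> nat \<Rightarrow> real vec \<Rightarrow> nat \<Rightarrow> real" where
  "par_theta p r \<nu> s = \<nu> $ (r + p + s)"


section \<open>The recursion\<close>

(* Time is an integer. Only the values y t and x t with t >= 1 are ever used: the pre-sample
   conventions g(Y_t) = 0, x_t = 0, r_t = 0 for t <= 0 are built into gobs, cov and res. *)

definition gobs :: "(real \<Rightarrow> real) \<Rightarrow> (int \<Rightarrow> real) \<Rightarrow> int \<Rightarrow> real" where
  "gobs g y t = (if t \<le> 0 then 0 else g (y t))"

definition cov :: "nat \<Rightarrow> (int \<Rightarrow> real vec) \<Rightarrow> int \<Rightarrow> real vec" where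
  "cov r x t = (if t \<le> 0 then 0\<^sub>v r else x t)"

function eta :: "(real \<Rightarrow> real) \<Rightarrow> nat \<Rightarrow> nat \<Rightarrow> nat \<Rightarrow> (int \<Rightarrow> real) \<Rightarrow> (int \<Rightarrow> real vec) \<Rightarrow>
    real vec \<Rightarrow> int \<Rightarrow> real"
  and res :: "(real \<Rightarrow> real) \<Rightarrow> nat \<Rightarrow> nat \<Rightarrow> nat \<Rightarrow> (int \<Rightarrow> real) \<Rightarrow> (int \<Rightarrow> real vec) \<Rightarrow>
    real vec \<Rightarrow> int \<Rightarrow> real"
where
  "eta g p q r y x \<nu> t =
     par_alpha \<nu> + cov r x t \<bullet> par_beta r \<nu>
     + (\<Sum>i\<in>{1..p}. par_phi r \<nu> i *
          (gobs g y (t - int i) - cov r x (t - int i) \<bullet> par_beta r \<nu>))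
     + (\<Sum>j\<in>{1..q}. par_theta p r \<nu> j * res g p q r y x \<nu> (t - int j))"
| "res g p q r y x \<nu> t =
     (if t \<le> 0 then 0 else g (y t) - g (inv_link g (eta g p q r y x \<nu> t)))"
  by pat_completeness auto
termination
  by (relation "Wellfounded.measure (\<lambda>a. case a of
        Inl (g, p, q, r, y, x, \<nu>, t) \<Rightarrow> 2 * nat t + 1
      | Inr (g, p, q, r, y, x, \<nu>, t) \<Rightarrow> if t > 0 then 2 * nat t + 2 else 0)") auto

declare eta.simps [simp del] res.simps [simp del]

definition mu :: "(real \<Rightarrow> real) \<Rightarrow> nat \<Rightarrow> nat \<Rightarrow> nat \<Rightarrow> (int \<Rightarrow> real) \<Rightarrow> (int \<Rightarrow> real vec) \<Rightarrow>
    real vec \<Rightarrow> int \<Rightarrow> real" where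
  "mu g p q r y x \<nu> t = inv_link g (eta g p q r y x \<nu> t)"


section \<open>The UWARMA model\<close>

definition ar_poly :: "nat \<Rightarrow> nat \<Rightarrow> real vec \<Rightarrow> complex \<Rightarrow> complex" where
  "ar_poly p r \<nu> z = 1 - (\<Sum>i\<in>{1..p}. complex_of_real (par_phi r \<nu> i) * z ^ i)"

definition ma_poly :: "nat \<Rightarrow> nat \<Rightarrow> nat \<Rightarrow> real vec \<Rightarrow> complex \<Rightarrow> complex" where
  "ma_poly p q r \<nu> z = 1 + (\<Sum>j\<in>{1..q}. complex_of_real (par_theta p r \<nu> j) * z ^ j)"

(* The sigma-field F_{t-1}, which contains x_t; the pre-sample values are constants and
   contribute nothing to it. *)
definition past_sigma :: "'a measure \<Rightarrow> nat \<Rightarrow> (int \<Rightarrow> 'a \<Rightarrow> real) \<Rightarrow> (int \<Rightarrow> 'a \<Rightarrow> real vec) \<Rightarrow>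
    int \<Rightarrow> 'a measure" where
  "past_sigma M r Y X t = sigma (space M)
     ({Y s -` B \<inter> space M | s B. 1 \<le> s \<and> s < t \<and> B \<in> sets borel} \<union>
      {(\<lambda>\<omega>. X s \<omega> $ l) -` B \<inter> space M | s l B. 1 \<le> s \<and> s \<le> t \<and> l < r \<and> B \<in> sets borel})"

locale uwarma = prob_space M
  for M :: "'a measure" +
  fixes \<rho> :: real and g :: "real \<Rightarrow> real" and p q r :: nat
    and \<nu> :: "real vec" and lam :: real
    and Y :: "int \<Rightarrow> 'a \<Rightarrow> real" and X :: "int \<Rightarrow> 'a \<Rightarrow> real vec"
  assumes rho: "0 < \<rho>" "\<rho> < 1"
    and link: "link_function g"
    and par_nu: "\<nu> \<in> carrier_vec (1 + r + p + q)"
    and par_lambda: "0 < lam"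
    and no_common_roots: "\<not> (\<exists>z. ar_poly p r \<nu> z = 0 \<and> ma_poly p q r \<nu> z = 0)"
    and no_unit_roots: "\<not> (\<exists>z. cmod z = 1 \<and> ar_poly p r \<nu> z = 0)"
    and Y_measurable: "\<And>t. 1 \<le> t \<Longrightarrow> Y t \<in> borel_measurable M"
    and Y_range: "\<And>t \<omega>. 1 \<le> t \<Longrightarrow> \<omega> \<in> space M \<Longrightarrow> 0 < Y t \<omega> \<and> Y t \<omega> < 1"
    and X_carrier: "\<And>t \<omega>. 1 \<le> t \<Longrightarrow> \<omega> \<in> space M \<Longrightarrow> X t \<omega> \<in> carrier_vec r"
    and X_measurable: "\<And>t l. 1 \<le> t \<Longrightarrow> l < r \<Longrightarrow> (\<lambda>\<omega>. X t \<omega> $ l) \<in> borel_measurable M"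
    and conditional_law: "\<And>t B. 1 \<le> t \<Longrightarrow> B \<in> sets borel \<Longrightarrow>
      AE \<omega> in M. real_cond_exp M (past_sigma M r Y X t) (indicator (Y t -` B \<inter> space M)) \<omega>
        = measure (uw_law \<rho> (mu g p q r (\<lambda>s. Y s \<omega>) (\<lambda>s. X s \<omega>) \<nu> t) lam) B"


section \<open>Partial log-likelihood and score\<close>

definition uw_A :: "real \<Rightarrow> real \<Rightarrow> real" where
  "uw_A y \<mu> = ln y / ln \<mu>"

definition uw_ell :: "real \<Rightarrow> real \<Rightarrow> real \<Rightarrow> real \<Rightarrow> real" where
  "uw_ell \<rho> y \<mu> lam =
     ln lam - ln y + ln (ln \<rho> / ln \<mu>) + (lam - 1) * ln (uw_A y \<mu>) + ln \<rho> * uw_A y \<mu> powr lam"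

(* The full parameter is gamma = (nu, lambda), with lambda in the last position. *)
definition loglik :: "real \<Rightarrow> (real \<Rightarrow> real) \<Rightarrow> nat \<Rightarrow> nat \<Rightarrow> nat \<Rightarrow> nat \<Rightarrow> (int \<Rightarrow> real) \<Rightarrow>
    (int \<Rightarrow> real vec) \<Rightarrow> real vec \<Rightarrow> real" where
  "loglik \<rho> g p q r n y x \<gamma> =
     (\<Sum>t\<in>{1..int n}. uw_ell \<rho> (y t) (mu g p q r y x (vec_first \<gamma> (1 + r + p + q)) t)
        (\<gamma> $ (1 + r + p + q)))"

(* d_eta ... nu c t is the derivative of eta_t in the coordinate of nu with index c, with the
   convention that it vanishes for t <= 0. *)
definition d_eta :: "(real \<Rightarrow> real) \<Rightarrow> nat \<Rightarrow> nat \<Rightarrow> nat \<Rightarrow> (int \<Rightarrow> real) \<Rightarrow> (int \<Rightarrow> real vec) \<Rightarrow>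
    real vec \<Rightarrow> nat \<Rightarrow> int \<Rightarrow> real" where
  "d_eta g p q r y x \<nu> c t =
     (if t \<le> 0 then 0 else partial_deriv (\<lambda>\<nu>'. eta g p q r y x \<nu>' t) \<nu> c)"

(* In the next four definitions, row i belongs to time i + 1. *)

definition D_mat :: "(real \<Rightarrow> real) \<Rightarrow> nat \<Rightarrow> nat \<Rightarrow> nat \<Rightarrow> nat \<Rightarrow> (int \<Rightarrow> real) \<Rightarrow>
    (int \<Rightarrow> real vec) \<Rightarrow> real vec \<Rightarrow> real mat" where
  "D_mat g p q r n y x \<nu> =
     mat n (1 + r + p + q) (\<lambda>(i, c). d_eta g p q r y x \<nu> c (int i + 1))"

definition T_mat :: "(real \<Rightarrow> real) \<Rightarrow> nat \<Rightarrow> nat \<Rightarrow> nat \<Rightarrow> nat \<Rightarrow> (int \<Rightarrow> real) \<Rightarrow>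
    (int \<Rightarrow> real vec) \<Rightarrow> real vec \<Rightarrow> real mat" where
  "T_mat g p q r n y x \<nu> =
     mat n n (\<lambda>(i, j). if i = j then 1 / deriv g (mu g p q r y x \<nu> (int i + 1)) else 0)"

definition h1_vec :: "real \<Rightarrow> (real \<Rightarrow> real) \<Rightarrow> nat \<Rightarrow> nat \<Rightarrow> nat \<Rightarrow> nat \<Rightarrow> (int \<Rightarrow> real) \<Rightarrow>
    (int \<Rightarrow> real vec) \<Rightarrow> real vec \<Rightarrow> real \<Rightarrow> real vec" where
  "h1_vec \<rho> g p q r n y x \<nu> lam =
     vec n (\<lambda>i. deriv (\<lambda>m. uw_ell \<rho> (y (int i + 1)) m lam) (mu g p q r y x \<nu> (int i + 1)))"

definition h2_vec :: "real \<Rightarrow> (real \<Rightarrow> real) \<Rightarrow> nat \<Rightarrow> nat \<Rightarrow> nat \<Rightarrow> nat \<Rightarrow> (int \<Rightarrow> real) \<Rightarrow>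
    (int \<Rightarrow> real vec) \<Rightarrow> real vec \<Rightarrow> real \<Rightarrow> real vec" where
  "h2_vec \<rho> g p q r n y x \<nu> lam =
     vec n (\<lambda>i. deriv (\<lambda>l. uw_ell \<rho> (y (int i + 1)) (mu g p q r y x \<nu> (int i + 1)) l) lam)"

definition ones_vec :: "nat \<Rightarrow> real vec" where
  "ones_vec n = vec n (\<lambda>_. 1)"

end

theory Submission
  imports Defs
begin

text \<open>Since g maps (0,1) onto the reals, g(mu_t) = eta_t, so the residual is r_t = g(y_t) -
  eta_t and the link cancels from the recursion (\<open>res_eq\<close>). Thus eta_t is built from
  the data, the parameters and the earlier eta's by sums and products only. Strong induction on t
  with the product rule yields existence of all partial derivatives of eta_t and their recursion
  together (\<open>eta_derivative\<close>); each term theta_j r_{t-j} contributes -theta_j times a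
  lagged derivative of eta, plus r_{t-j} itself when theta_j is the active coordinate. Reading the
  formula coordinate by coordinate gives the four recursions (\<open>d_eta_recursion\<close>).

  For the score, ell_t depends on nu only through mu_t, the inverse link of eta_t. The inverse link
  has derivative 1/g'(mu_t) (\<open>inv_link_derivative\<close>), so the chain rule gives a sum over
  t of the mu-derivative of ell_t, times 1/g'(mu_t), times the derivative of eta_t. As T is
  diagonal, this is one entry of D' T h1 (\<open>score_nu_index\<close>). The parameter lambda does
  not enter mu_t, so its component is the sum of the entries of h2 (\<open>score_lambda\<close>).
  The closed forms of the derivatives of ell_t are direct calculus, using that the logarithms of
  rho, y and mu are all negative.\<close>

section \<open>Derivatives along one coordinate of a vector\<close>

lemma dim_vec_upd [simp]: "dim_vec (vec_upd v c s) = dim_vec v"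
  by (simp add: vec_upd_def)

text \<open>As a simp rule, this turns the factors left by the product and chain rules at the base
  point into values at the unperturbed vector.\<close>

lemma vec_upd_triv [simp]: "vec_upd v c (v $ c) = v"
  by (auto simp: vec_upd_def)

lemma vec_upd_index_derivative:
  assumes "i < dim_vec v"
  shows "((\<lambda>s. vec_upd v c s $ i) has_real_derivative of_bool (i = c)) F"
proof (cases "i = c")
  case True
  then have "(\<lambda>s. vec_upd v c s $ i) = (\<lambda>s. s)"
    using assms by (simp add: vec_upd_def)
  with True show ?thesis by simp
next
  case False
  then have "(\<lambda>s. vec_upd v c s $ i) = (\<lambda>s. v $ i)"
    using assms by (simp add: vec_upd_def)
  with False show ?thesis by simp
qed

text \<open>\<open>deriv\<close> denotes some number even where no derivative exists, so a value of
  \<open>partial_deriv\<close> is informative only together with differentiability; both are read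
  off one \<open>has_real_derivative\<close> fact.\<close>

lemma partial_derivI:
  assumes "((\<lambda>s. F (vec_upd v c s)) has_real_derivative D) (at (v $ c))"
  shows "partial_differentiable F v c" and "partial_deriv F v c = D"
  using assms by (auto simp: partial_differentiable_def partial_deriv_def real_differentiable_def
      intro: DERIV_imp_deriv)

section \<open>Calculus of the unit-Weibull log-density\<close>

lemma uw_A_pos:
  assumes "0 < y" "y < 1" "0 < m" "m < 1"
  shows "0 < uw_A y m"
  using assms by (simp add: uw_A_def divide_neg_neg)

lemma uw_ell_derivative_lambda:
  assumes "0 < y" "y < 1" "0 < m" "m < 1" "0 < l"
  shows "((\<lambda>l'. uw_ell \<rho> y m l') has_real_derivative
    1 / l + (1 + uw_A y m powr l * ln \<rho>) * ln (uw_A y m)) (at l)"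
  unfolding uw_ell_def using uw_A_pos[OF assms(1-4)] assms
  by (auto intro!: derivative_eq_intros simp: algebra_simps)

text \<open>Writing A for \<open>uw_A y m\<close>, one has dA/dm = -A/(m ln m). Hence both
  logarithmic terms have derivative -1/(m ln m), and A^l has derivative -l A^l/(m ln m). The weights
  1 and l - 1 of the logarithms add up to the common factor l.\<close>

lemma uw_ell_derivative_mu:
  assumes "0 < \<rho>" "\<rho> < 1" "0 < y" "y < 1" "0 < m" "m < 1"
  shows "((\<lambda>m'. uw_ell \<rho> y m' l) has_real_derivative
    - (l * (1 + ln \<rho> * uw_A y m powr l) / (m * ln m))) (at m)"
proof -
  have A: "0 < uw_A y m" and r: "0 < ln \<rho> / ln m" and m: "ln m < 0" and rho: "ln \<rho> < 0"
    and y: "ln y < 0"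
    using assms by (auto simp: uw_A_pos divide_neg_neg)
  have dA: "((\<lambda>m'. uw_A y m') has_real_derivative - (uw_A y m / (m * ln m))) (at m)"
    unfolding uw_A_def using m assms
    by (auto intro!: derivative_eq_intros simp: field_simps)
  have dr: "((\<lambda>m'. ln (ln \<rho> / ln m')) has_real_derivative - (1 / (m * ln m))) (at m)"
    using m r rho assms by (auto intro!: derivative_eq_intros simp: field_simps)
  have dl: "((\<lambda>m'. ln (uw_A y m')) has_real_derivative - (1 / (m * ln m))) (at m)"
    using A m assms by (auto intro!: derivative_eq_intros dA simp: field_simps)
  have dp: "((\<lambda>m'. uw_A y m' powr l) has_real_derivative
      - (l * uw_A y m powr l / (m * ln m))) (at m)"
    using DERIV_fun_powr[OF dA A, of l] A by (simp add: powr_diff)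
  show ?thesis
    unfolding uw_ell_def
    by (rule derivative_eq_intros dr dl dp refl)+ (use m assms in \<open>simp add: field_simps\<close>)
qed

section \<open>The inverse link\<close>

text \<open>Surjectivity of the link onto the reals makes every real value of eta admissible, so mu
  always lies in (0,1) without restricting the parameters.\<close>

lemma
  assumes "link_function g"
  shows inv_link_range: "0 < inv_link g e" "inv_link g e < 1"
    and link_inv_link [simp]: "g (inv_link g e) = e"
proof -
  have e: "e \<in> g ` {0<..<1}"
    using assms by (simp add: link_function_def bij_betw_def)
  from inv_into_into[OF e] show "0 < inv_link g e" "inv_link g e < 1"
    by (simp_all add: inv_link_def)
  from f_inv_into_f[OF e] show "g (inv_link g e) = e"
    by (simp add: inv_link_def)
qed

lemma inv_link_link:
  assumes "link_function g" "0 < u" "u < 1"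
  shows "inv_link g (g u) = u"
  using assms by (simp add: link_function_def bij_betw_def inv_link_def)

text \<open>One-dimensional inverse function theorem: continuity of the inverse comes from
  continuity and injectivity of g near u, and the nonvanishing derivative of g is then
  inverted.\<close>

lemma inv_link_derivative:
  assumes link: "link_function g"
  shows "(inv_link g has_real_derivative 1 / deriv g (inv_link g e)) (at e)"
proof -
  define u where "u = inv_link g e"
  have u: "0 < u" "u < 1" and gu: "g u = e"
    using inv_link_range[OF link] link_inv_link[OF link] by (simp_all add: u_def)
  have diff: "g differentiable (at z)" if "0 < z" "z < 1" for z
    using link that by (simp add: link_function_def)
  \<comment> \<open>Half the distance from u to the boundary of (0,1), so that the closed
    d-neighbourhood of u stays inside the domain of the link.\<close>
  define d where "d = min u (1 - u) / 2"
  have near: "0 < z" "z < 1" if "\<bar>z - u\<bar> \<le> d" for z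
    using that u by (auto simp: d_def abs_if min_def split: if_splits)
  have "isCont (inv_link g) (g u)"
  proof (rule isCont_inverse_function[where d = d and f = g])
    show "0 < d" using u by (simp add: d_def)
    show "inv_link g (g z) = z" if "\<bar>z - u\<bar> \<le> d" for z
      using near[OF that] by (rule inv_link_link[OF link])
    show "isCont g z" if "\<bar>z - u\<bar> \<le> d" for z
      using diff[OF near[OF that]] by (auto intro: differentiable_imp_continuous_within)
  qed
  moreover have "(g has_real_derivative deriv g u) (at u)"
    using diff[OF u] by (simp add: DERIV_deriv_iff_real_differentiable)
  moreover have "deriv g u \<noteq> 0"
    using link u by (simp add: link_function_def)
  ultimately have "(inv_link g has_real_derivative inverse (deriv g u)) (at e)"
    \<comment> \<open>The identity \<open>g (inv_link g e) = e\<close> holds for all real e, so any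
      open interval around e serves; radius 1 is arbitrary.\<close>
    using link by (intro DERIV_inverse_function[of g _ _ _ "e - 1" "e + 1"]) (simp_all add: gu u_def)
  then show ?thesis by (simp add: u_def inverse_eq_divide)
qed

lemma mu_range:
  assumes "link_function g"
  shows "0 < mu g p q r y x \<nu>' t" "mu g p q r y x \<nu>' t < 1"
  using inv_link_range[OF assms] by (simp_all add: mu_def)

text \<open>Since \<open>g (\<mu>\<^sub>t) = \<eta>\<^sub>t\<close>, the link disappears from the recursion: \<open>r\<^sub>t = g (y\<^sub>t) - \<eta>\<^sub>t\<close>, so
  \<open>\<eta>\<^sub>t\<close> is a polynomial in the parameters.\<close>

lemma res_eq:
  assumes "link_function g"
  shows "res g p q r y x \<nu>' t = (if t \<le> 0 then 0 else g (y t) - eta g p q r y x \<nu>' t)"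
  using assms by (subst res.simps) simp

text \<open>Bridge between integer times starting at 1 and matrix rows starting at 0.\<close>

lemma sum_times_rows: "(\<Sum>t\<in>{1..int n}. f t) = (\<Sum>i<n. f (int i + 1))"
  for f :: "int \<Rightarrow> real"
  by (rule sum.reindex_bij_witness[of _ "\<lambda>i. int i + 1" "\<lambda>t. nat (t - 1)"]) auto

section \<open>Differentiating the recursion for eta\<close>

context
  fixes g :: "real \<Rightarrow> real" and p q r :: nat and y :: "int \<Rightarrow> real" and x :: "int \<Rightarrow> real vec"
    and \<nu> :: "real vec"
  assumes link: "link_function g" and \<nu>: "\<nu> \<in> carrier_vec (1 + r + p + q)"
begin

lemma par_derivatives:
  shows "((\<lambda>s. par_alpha (vec_upd \<nu> c s)) has_real_derivative of_bool (0 = c)) (at u)"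
    and "((\<lambda>s. a \<bullet> par_beta r (vec_upd \<nu> c s)) has_real_derivative
           (\<Sum>l<r. a $ l * of_bool (l + 1 = c))) (at u)"
    and "k \<in> {1..p} \<Longrightarrow>
           ((\<lambda>s. par_phi r (vec_upd \<nu> c s) k) has_real_derivative of_bool (r + k = c)) (at u)"
    and "j \<in> {1..q} \<Longrightarrow>
           ((\<lambda>s. par_theta p r (vec_upd \<nu> c s) j) has_real_derivative of_bool (r + p + j = c)) (at u)"
proof -
  have dim: "dim_vec \<nu> = 1 + r + p + q" using \<nu> by simp
  note D = vec_upd_index_derivative[where v = \<nu>, unfolded dim]
  show "((\<lambda>s. par_alpha (vec_upd \<nu> c s)) has_real_derivative of_bool (0 = c)) (at u)"
    unfolding par_alpha_def by (rule D) simp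
  have "((\<lambda>s. \<Sum>l<r. a $ l * vec_upd \<nu> c s $ (l + 1)) has_real_derivative
      (\<Sum>l<r. a $ l * of_bool (l + 1 = c))) (at u)"
    by (intro DERIV_sum DERIV_cmult D) simp
  then show "((\<lambda>s. a \<bullet> par_beta r (vec_upd \<nu> c s)) has_real_derivative
      (\<Sum>l<r. a $ l * of_bool (l + 1 = c))) (at u)"
    by (simp add: scalar_prod_def par_beta_def atLeast0LessThan)
  show "k \<in> {1..p} \<Longrightarrow>
      ((\<lambda>s. par_phi r (vec_upd \<nu> c s) k) has_real_derivative of_bool (r + k = c)) (at u)"
    unfolding par_phi_def by (rule D) simp
  show "j \<in> {1..q} \<Longrightarrow>
      ((\<lambda>s. par_theta p r (vec_upd \<nu> c s) j) has_real_derivative of_bool (r + p + j = c)) (at u)"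
    unfolding par_theta_def by (rule D) simp
qed

lemma d_eta_eqI:
  assumes "((\<lambda>s. eta g p q r y x (vec_upd \<nu> c s) t) has_real_derivative D) (at (\<nu> $ c))"
    and "t \<ge> 1"
  shows "d_eta g p q r y x \<nu> c t = D"
  using partial_derivI(2)[where F = "\<lambda>\<nu>'. eta g p q r y x \<nu>' t", OF assms(1)] assms(2)
  by (simp add: d_eta_def)

text \<open>The formal derivative of the recursion in coordinate c, with Kronecker deltas marking
  the active parameter, so that one induction covers all four blocks. The lagged derivatives appear
  as \<open>d_eta\<close>, hence the definition is not itself recursive.\<close>

definition d_eta_rhs :: "nat \<Rightarrow> int \<Rightarrow> real" where
  "d_eta_rhs c t = of_bool (0 = c) + (\<Sum>l<r. cov r x t $ l * of_bool (l + 1 = c))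
     + (\<Sum>i\<in>{1..p}. of_bool (r + i = c) * (gobs g y (t - int i) - cov r x (t - int i) \<bullet> par_beta r \<nu>)
         - par_phi r \<nu> i * (\<Sum>l<r. cov r x (t - int i) $ l * of_bool (l + 1 = c)))
     + (\<Sum>j\<in>{1..q}. of_bool (r + p + j = c) * res g p q r y x \<nu> (t - int j)
         - par_theta p r \<nu> j * d_eta g p q r y x \<nu> c (t - int j))"

text \<open>Only strictly earlier residuals occur in eta_t, so strong induction on t supplies their
  derivatives; the observations are constants in the parameter.\<close>

lemma eta_derivative:
  assumes "t \<ge> 1"
  shows "((\<lambda>s. eta g p q r y x (vec_upd \<nu> c s) t) has_real_derivative d_eta_rhs c t) (at (\<nu> $ c))"
  using assms
proof (induction "nat t" arbitrary: t rule: less_induct)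
  case less
  have res_derivative: "((\<lambda>s. res g p q r y x (vec_upd \<nu> c s) (t - int j)) has_real_derivative
      - d_eta g p q r y x \<nu> c (t - int j)) (at (\<nu> $ c))" if j: "j \<in> {1..q}" for j
  proof (cases "t - int j \<le> 0")
    \<comment> \<open>Before the sample the residual is constantly 0, matching the convention that
      \<open>d_eta\<close> vanishes there.\<close>
    case True
    then show ?thesis by (simp add: res_eq[OF link] d_eta_def)
  next
    case False
    have "((\<lambda>s. eta g p q r y x (vec_upd \<nu> c s) (t - int j)) has_real_derivative
        d_eta_rhs c (t - int j)) (at (\<nu> $ c))"
      by (rule less.hyps) (use False j in auto)
    \<comment> \<open>Uniqueness of the derivative replaces the expanded formula from the induction
      hypothesis by \<open>d_eta\<close>, the form in which lags enter
      \<open>d_eta_rhs\<close>.\<close>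
    with d_eta_eqI[OF this] False
    have "((\<lambda>s. eta g p q r y x (vec_upd \<nu> c s) (t - int j)) has_real_derivative
        d_eta g p q r y x \<nu> c (t - int j)) (at (\<nu> $ c))" by simp
    then have "((\<lambda>s. g (y (t - int j)) - eta g p q r y x (vec_upd \<nu> c s) (t - int j))
        has_real_derivative 0 - d_eta g p q r y x \<nu> c (t - int j)) (at (\<nu> $ c))"
      by (intro DERIV_diff DERIV_const)
    then show ?thesis using False by (simp add: res_eq[OF link])
  qed
  show ?case
    unfolding eta.simps[of g p q r y x _ t] d_eta_rhs_def
  proof (intro DERIV_add DERIV_sum par_derivatives)
    fix i assume i: "i \<in> {1..p}"
    show "((\<lambda>s. par_phi r (vec_upd \<nu> c s) i *
        (gobs g y (t - int i) - cov r x (t - int i) \<bullet> par_beta r (vec_upd \<nu> c s)))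
      has_real_derivative
        of_bool (r + i = c) * (gobs g y (t - int i) - cov r x (t - int i) \<bullet> par_beta r \<nu>)
        - par_phi r \<nu> i * (\<Sum>l<r. cov r x (t - int i) $ l * of_bool (l + 1 = c))) (at (\<nu> $ c))"
      by (rule DERIV_cong, rule DERIV_mult[OF par_derivatives(3)[OF i]
            DERIV_diff[OF DERIV_const par_derivatives(2)]]) (simp add: algebra_simps)
  next
    fix j assume j: "j \<in> {1..q}"
    show "((\<lambda>s. par_theta p r (vec_upd \<nu> c s) j * res g p q r y x (vec_upd \<nu> c s) (t - int j))
      has_real_derivative of_bool (r + p + j = c) * res g p q r y x \<nu> (t - int j)
        - par_theta p r \<nu> j * d_eta g p q r y x \<nu> c (t - int j)) (at (\<nu> $ c))"
      by (rule DERIV_cong, rule DERIV_mult[OF par_derivatives(4)[OF j] res_derivative[OF j]])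
        (simp add: algebra_simps)
  qed
qed

lemma d_eta_eq:
  assumes "t \<ge> 1"
  shows "d_eta g p q r y x \<nu> c t = d_eta_rhs c t"
  by (rule d_eta_eqI) (use assms in \<open>auto intro: eta_derivative\<close>)

text \<open>The parameter blocks occupy disjoint index ranges, so for each c at most one group of
  deltas in \<open>d_eta_rhs\<close> survives.\<close>

lemma d_eta_recursion:
  assumes "t \<ge> 1"
  shows "d_eta g p q r y x \<nu> 0 t =
      1 - (\<Sum>j\<in>{1..q}. par_theta p r \<nu> j * d_eta g p q r y x \<nu> 0 (t - int j))"
    and "l \<in> {1..r} \<Longrightarrow> d_eta g p q r y x \<nu> l t =
      x t $ (l - 1) - (\<Sum>i\<in>{1..p}. par_phi r \<nu> i * cov r x (t - int i) $ (l - 1))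
      - (\<Sum>j\<in>{1..q}. par_theta p r \<nu> j * d_eta g p q r y x \<nu> l (t - int j))"
    and "k \<in> {1..p} \<Longrightarrow> d_eta g p q r y x \<nu> (r + k) t =
      gobs g y (t - int k) - cov r x (t - int k) \<bullet> par_beta r \<nu>
      - (\<Sum>j\<in>{1..q}. par_theta p r \<nu> j * d_eta g p q r y x \<nu> (r + k) (t - int j))"
    and "s \<in> {1..q} \<Longrightarrow> d_eta g p q r y x \<nu> (r + p + s) t =
      res g p q r y x \<nu> (t - int s)
      - (\<Sum>i\<in>{1..q}. par_theta p r \<nu> i * d_eta g p q r y x \<nu> (r + p + s) (t - int i))"
proof -
  have beta0: "(\<Sum>l<r. a $ l * of_bool (l + 1 = c)) = 0" if "c = 0 \<or> c > r"
    for a :: "real vec" and c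
    using that by (intro sum.neutral) auto
  \<comment> \<open>The coefficient beta_l has index l in the parameter vector but multiplies the
    covariate component with index l - 1, because alpha occupies index 0.\<close>
  have beta: "(\<Sum>l<r. a $ l * of_bool (l + 1 = c)) = a $ (c - 1)" if "c \<in> {1..r}"
    for a :: "real vec" and c
  proof -
    have "(\<Sum>l<r. a $ l * of_bool (l + 1 = c)) = (\<Sum>l<r. if l = c - 1 then a $ l else 0)"
      using that by (intro sum.cong) auto
    moreover have "c - 1 < r" using that by auto
    ultimately show ?thesis by simp
  qed
  \<comment> \<open>Here b is the offset of a block. If c is at most b, truncated subtraction gives
    c - b = 0, which lies outside the summation range, in agreement with the guard.\<close>
  have delta: "(\<Sum>i\<in>{1..m}. of_bool (b + i = c) * f i) = (if b < c \<and> c \<le> b + m then f (c - b) else 0)"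
    for f :: "nat \<Rightarrow> real" and m b c :: nat
  proof -
    have "(\<Sum>i\<in>{1..m}. of_bool (b + i = c) * f i) =
        (\<Sum>i\<in>{1..m}. if i = c - b then of_bool (b + i = c) * f i else 0)"
      by (intro sum.cong) auto
    then show ?thesis by auto
  qed
  have rhs: "d_eta g p q r y x \<nu> c t = of_bool (0 = c)
      + (\<Sum>l<r. cov r x t $ l * of_bool (l + 1 = c))
      + ((if r < c \<and> c \<le> r + p
          then gobs g y (t - int (c - r)) - cov r x (t - int (c - r)) \<bullet> par_beta r \<nu> else 0)
        - (\<Sum>i\<in>{1..p}. par_phi r \<nu> i * (\<Sum>l<r. cov r x (t - int i) $ l * of_bool (l + 1 = c))))
      + ((if r + p < c \<and> c \<le> r + p + q then res g p q r y x \<nu> (t - int (c - (r + p))) else 0)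
        - (\<Sum>j\<in>{1..q}. par_theta p r \<nu> j * d_eta g p q r y x \<nu> c (t - int j)))" for c
    unfolding d_eta_eq[OF assms] d_eta_rhs_def sum_subtractf delta ..
  show "d_eta g p q r y x \<nu> 0 t =
      1 - (\<Sum>j\<in>{1..q}. par_theta p r \<nu> j * d_eta g p q r y x \<nu> 0 (t - int j))"
    by (subst rhs) (simp add: beta0)
  show "d_eta g p q r y x \<nu> l t =
      x t $ (l - 1) - (\<Sum>i\<in>{1..p}. par_phi r \<nu> i * cov r x (t - int i) $ (l - 1))
      - (\<Sum>j\<in>{1..q}. par_theta p r \<nu> j * d_eta g p q r y x \<nu> l (t - int j))" if "l \<in> {1..r}"
    using that assms by (subst rhs) (simp only: beta[OF that], simp add: cov_def)
  show "d_eta g p q r y x \<nu> (r + k) t =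
      gobs g y (t - int k) - cov r x (t - int k) \<bullet> par_beta r \<nu>
      - (\<Sum>j\<in>{1..q}. par_theta p r \<nu> j * d_eta g p q r y x \<nu> (r + k) (t - int j))"
    if "k \<in> {1..p}"
    \<comment> \<open>An index above r meets no beta coordinate, so the covariate contributions at
      time t and at the autoregressive lags both vanish.\<close>
    using that by (subst rhs) (subst (1 2) beta0, simp_all)
  show "d_eta g p q r y x \<nu> (r + p + s) t = res g p q r y x \<nu> (t - int s)
      - (\<Sum>i\<in>{1..q}. par_theta p r \<nu> i * d_eta g p q r y x \<nu> (r + p + s) (t - int i))"
    if "s \<in> {1..q}"
    using that by (subst rhs) (subst (1 2) beta0, simp_all)
qed

section \<open>Chain rule for the log-likelihood\<close>

lemma mu_derivative:
  assumes "t \<ge> 1"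
  shows "((\<lambda>s. mu g p q r y x (vec_upd \<nu> c s) t) has_real_derivative
    d_eta g p q r y x \<nu> c t / deriv g (mu g p q r y x \<nu> t)) (at (\<nu> $ c))"
  using DERIV_chain2[where f = "inv_link g" and g = "\<lambda>s. eta g p q r y x (vec_upd \<nu> c s) t",
      OF inv_link_derivative[OF link] eta_derivative[OF assms]]
  by (simp add: mu_def d_eta_eq[OF assms])

lemma loglik_derivative_nu:
  assumes "0 < \<rho>" "\<rho> < 1" and y: "\<And>t. t \<in> {1..int n} \<Longrightarrow> 0 < y t \<and> y t < 1"
    and c: "c < 1 + r + p + q"
  shows "((\<lambda>s. loglik \<rho> g p q r n y x (vec_upd (\<nu> @\<^sub>v vec 1 (\<lambda>_. lam)) c s)) has_real_derivative
    (\<Sum>t\<in>{1..int n}. deriv (\<lambda>m. uw_ell \<rho> (y t) m lam) (mu g p q r y x \<nu> t)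
       * (d_eta g p q r y x \<nu> c t / deriv g (mu g p q r y x \<nu> t)))) (at (\<nu> $ c))"
proof -
  have dim: "dim_vec \<nu> = 1 + r + p + q" using \<nu> by simp
  \<comment> \<open>Moving a coordinate below the last one changes only the nu part of gamma and
    leaves lambda fixed.\<close>
  have *: "vec_first (vec_upd (\<nu> @\<^sub>v vec 1 (\<lambda>_. lam)) c s) (1 + r + p + q) = vec_upd \<nu> c s"
    and **: "vec_upd (\<nu> @\<^sub>v vec 1 (\<lambda>_. lam)) c s $ (1 + r + p + q) = lam" for s
    using c dim by (auto simp: vec_first_def vec_upd_def)
  show ?thesis
    unfolding loglik_def * **
  proof (rule DERIV_sum)
    fix t assume t: "t \<in> {1..int n}"
    have "((\<lambda>m. uw_ell \<rho> (y t) m lam) has_real_derivative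
        deriv (\<lambda>m. uw_ell \<rho> (y t) m lam) (mu g p q r y x \<nu> t)) (at (mu g p q r y x \<nu> t))"
      using uw_ell_derivative_mu[OF assms(1,2) conjunct1[OF y[OF t]] conjunct2[OF y[OF t]]
          mu_range[OF link]]
      \<comment> \<open>The explicit derivative is traded for \<open>deriv\<close>, the form used in
        the entries of \<open>h1_vec\<close>.\<close>
      by (metis DERIV_imp_deriv)
    then show "((\<lambda>s. uw_ell \<rho> (y t) (mu g p q r y x (vec_upd \<nu> c s) t) lam) has_real_derivative
        deriv (\<lambda>m. uw_ell \<rho> (y t) m lam) (mu g p q r y x \<nu> t)
          * (d_eta g p q r y x \<nu> c t / deriv g (mu g p q r y x \<nu> t))) (at (\<nu> $ c))"
      using t by (intro DERIV_chain2[where g = "\<lambda>s. mu g p q r y x (vec_upd \<nu> c s) t"])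
        (auto intro: mu_derivative)
  qed
qed

lemma loglik_derivative_lambda:
  assumes y: "\<And>t. t \<in> {1..int n} \<Longrightarrow> 0 < y t \<and> y t < 1" and lam: "0 < lam"
  shows "((\<lambda>s. loglik \<rho> g p q r n y x (vec_upd (\<nu> @\<^sub>v vec 1 (\<lambda>_. lam)) (1 + r + p + q) s))
    has_real_derivative
    (\<Sum>t\<in>{1..int n}. deriv (\<lambda>l. uw_ell \<rho> (y t) (mu g p q r y x \<nu> t) l) lam)) (at lam)"
proof -
  have dim: "dim_vec \<nu> = 1 + r + p + q" using \<nu> by simp
  \<comment> \<open>Moving the last coordinate leaves nu, and therefore every mu_t,
    unchanged.\<close>
  have *: "vec_first (vec_upd (\<nu> @\<^sub>v vec 1 (\<lambda>_. lam)) (1 + r + p + q) s) (1 + r + p + q) = \<nu>"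
    and **: "vec_upd (\<nu> @\<^sub>v vec 1 (\<lambda>_. lam)) (1 + r + p + q) s $ (1 + r + p + q) = s" for s
    using dim by (auto simp: vec_first_def vec_upd_def)
  show ?thesis
    unfolding loglik_def * **
  proof (rule DERIV_sum)
    fix t assume t: "t \<in> {1..int n}"
    show "((\<lambda>l. uw_ell \<rho> (y t) (mu g p q r y x \<nu> t) l) has_real_derivative
        deriv (\<lambda>l. uw_ell \<rho> (y t) (mu g p q r y x \<nu> t) l) lam) (at lam)"
      using uw_ell_derivative_lambda[OF conjunct1[OF y[OF t]] conjunct2[OF y[OF t]] mu_range[OF link] lam]
      by (metis DERIV_imp_deriv)
  qed
qed

section \<open>Matrix form of the score\<close>

text \<open>Multiplying by the diagonal matrix T merely scales column i of D' by 1/g'(mu) at time i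
  + 1; the product with h1 is then the chain-rule sum over time.\<close>

lemma score_nu_index:
  assumes c: "c < 1 + r + p + q"
  shows "((D_mat g p q r n y x \<nu>)\<^sup>T * T_mat g p q r n y x \<nu> *\<^sub>v h1_vec \<rho> g p q r n y x \<nu> lam) $ c =
    (\<Sum>t\<in>{1..int n}. deriv (\<lambda>m. uw_ell \<rho> (y t) m lam) (mu g p q r y x \<nu> t)
       * (d_eta g p q r y x \<nu> c t / deriv g (mu g p q r y x \<nu> t)))"
proof -
  have entry: "((D_mat g p q r n y x \<nu>)\<^sup>T * T_mat g p q r n y x \<nu>) $$ (c, i) =
      d_eta g p q r y x \<nu> c (int i + 1) / deriv g (mu g p q r y x \<nu> (int i + 1))"
    if i: "i < n" for i
  proof -
    have "((D_mat g p q r n y x \<nu>)\<^sup>T * T_mat g p q r n y x \<nu>) $$ (c, i) =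
        (\<Sum>k<n. d_eta g p q r y x \<nu> c (int k + 1) *
           (if k = i then 1 / deriv g (mu g p q r y x \<nu> (int k + 1)) else 0))"
      using c i by (simp add: D_mat_def T_mat_def scalar_prod_def atLeast0LessThan)
    also have "\<dots> = (\<Sum>k<n. if k = i then d_eta g p q r y x \<nu> c (int k + 1) *
           (1 / deriv g (mu g p q r y x \<nu> (int k + 1))) else 0)"
      by (intro sum.cong) auto
    finally show ?thesis using i by simp
  qed
  have dims: "dim_row ((D_mat g p q r n y x \<nu>)\<^sup>T * T_mat g p q r n y x \<nu>) = 1 + r + p + q"
    "dim_col ((D_mat g p q r n y x \<nu>)\<^sup>T * T_mat g p q r n y x \<nu>) = n"
    by (simp_all add: D_mat_def T_mat_def)
  have "((D_mat g p q r n y x \<nu>)\<^sup>T * T_mat g p q r n y x \<nu> *\<^sub>v h1_vec \<rho> g p q r n y x \<nu> lam) $ c =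
      (\<Sum>i<n. ((D_mat g p q r n y x \<nu>)\<^sup>T * T_mat g p q r n y x \<nu>) $$ (c, i)
        * h1_vec \<rho> g p q r n y x \<nu> lam $ i)"
    using c dims by (simp add: scalar_prod_def h1_vec_def atLeast0LessThan del: index_mult_mat)
  also have "\<dots> = (\<Sum>i<n. deriv (\<lambda>m. uw_ell \<rho> (y (int i + 1)) m lam) (mu g p q r y x \<nu> (int i + 1))
       * (d_eta g p q r y x \<nu> c (int i + 1) / deriv g (mu g p q r y x \<nu> (int i + 1))))"
    by (intro sum.cong) (simp_all add: entry h1_vec_def del: index_mult_mat)
  finally show ?thesis by (simp add: sum_times_rows)
qed

lemma score_lambda:
  "ones_vec n \<bullet> h2_vec \<rho> g p q r n y x \<nu> lam =
    (\<Sum>t\<in>{1..int n}. deriv (\<lambda>l. uw_ell \<rho> (y t) (mu g p q r y x \<nu> t) l) lam)"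
  by (simp add: sum_times_rows scalar_prod_def ones_vec_def h2_vec_def atLeast0LessThan)

lemma score:
  assumes "0 < \<rho>" "\<rho> < 1" and y: "\<And>t. t \<in> {1..int n} \<Longrightarrow> 0 < y t \<and> y t < 1" and lam: "0 < lam"
  shows "\<forall>c<2 + r + p + q.
      partial_differentiable (loglik \<rho> g p q r n y x) (\<nu> @\<^sub>v vec 1 (\<lambda>_. lam)) c"
    and "gradient (loglik \<rho> g p q r n y x) (\<nu> @\<^sub>v vec 1 (\<lambda>_. lam)) =
      ((D_mat g p q r n y x \<nu>)\<^sup>T * T_mat g p q r n y x \<nu> *\<^sub>v h1_vec \<rho> g p q r n y x \<nu> lam)
      @\<^sub>v vec 1 (\<lambda>_. ones_vec n \<bullet> h2_vec \<rho> g p q r n y x \<nu> lam)"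
proof -
  let ?L = "loglik \<rho> g p q r n y x" and ?\<gamma> = "\<nu> @\<^sub>v vec 1 (\<lambda>_. lam)"
  let ?U = "(D_mat g p q r n y x \<nu>)\<^sup>T * T_mat g p q r n y x \<nu> *\<^sub>v h1_vec \<rho> g p q r n y x \<nu> lam"
  let ?S = "?U @\<^sub>v vec 1 (\<lambda>_. ones_vec n \<bullet> h2_vec \<rho> g p q r n y x \<nu> lam)"
  have dim: "dim_vec \<nu> = 1 + r + p + q" using \<nu> by simp
  have dimU: "dim_vec ?U = 1 + r + p + q" by (simp add: D_mat_def)
  \<comment> \<open>A single derivative statement for every coordinate, the last being lambda,
    yields both differentiability and the gradient.\<close>
  have *: "((\<lambda>s. ?L (vec_upd ?\<gamma> c s)) has_real_derivative ?S $ c) (at (?\<gamma> $ c))"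
    if "c < 2 + r + p + q" for c
  proof (cases "c < 1 + r + p + q")
    case True
    then have "?S $ c = ?U $ c" and "?\<gamma> $ c = \<nu> $ c"
      using dim dimU by (simp_all del: index_mult_mat_vec dim_mult_mat_vec)
    with loglik_derivative_nu[OF assms(1-3) True] score_nu_index[OF True] show ?thesis
      by simp
  next
    case False
    with that have c: "c = 1 + r + p + q" by simp
    then have "?S $ c = ones_vec n \<bullet> h2_vec \<rho> g p q r n y x \<nu> lam" and "?\<gamma> $ c = lam"
      using dim dimU by (simp_all del: index_mult_mat_vec dim_mult_mat_vec)
    with loglik_derivative_lambda[OF y lam] show ?thesis
      by (simp only: c score_lambda)
  qed
  show "\<forall>c<2 + r + p + q. partial_differentiable ?L ?\<gamma> c"
    using * by (blast intro: partial_derivI(1))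
  show "gradient ?L ?\<gamma> = ?S"
  proof (rule eq_vecI)
    show "dim_vec (gradient ?L ?\<gamma>) = dim_vec ?S"
      by (simp only: gradient_def dim_vec index_append_vec dim dimU)
    fix c assume "c < dim_vec ?S"
    then have c: "c < 2 + r + p + q"
      by (simp only: dim_vec index_append_vec dimU)
    then have "gradient ?L ?\<gamma> $ c = partial_deriv ?L ?\<gamma> c"
      using dim by (simp add: gradient_def)
    also have "\<dots> = ?S $ c"
      by (rule partial_derivI(2)) (rule *[OF c])
    finally show "gradient ?L ?\<gamma> $ c = ?S $ c" .
  qed
qed

end

section \<open>The score of a realized sample\<close>

theorem mainTheorem1:
  fixes n p q r :: nat and \<rho> :: real and g :: "real \<Rightarrow> real"
    and M :: "'a measure" and Y :: "int \<Rightarrow> 'a \<Rightarrow> real" and X :: "int \<Rightarrow> 'a \<Rightarrow> real vec"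
    and \<nu>\<^sub>0 :: "real vec" and lam\<^sub>0 :: real and \<omega> :: 'a
    and y :: "int \<Rightarrow> real" and x :: "int \<Rightarrow> real vec"
    and \<nu> :: "real vec" and lam :: real
  assumes "n \<ge> 1"
    and "0 < \<rho>" "\<rho> < 1"
    and model: "uwarma M \<rho> g p q r \<nu>\<^sub>0 lam\<^sub>0 Y X"
    and realization: "\<omega> \<in> space M"
      "\<forall>t\<in>{1..int n}. y t = Y t \<omega>" "\<forall>t\<in>{1..int n}. x t = X t \<omega>"
    and parameter: "\<nu> \<in> carrier_vec (1 + r + p + q)" "0 < lam"
  shows
    "(\<forall>t\<in>{1..int n}. \<forall>m\<in>{0<..<1}. \<forall>l>0.
       ((\<lambda>l'. uw_ell \<rho> (y t) m l') has_real_derivative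
          1 / l + (1 + uw_A (y t) m powr l * ln \<rho>) * ln (uw_A (y t) m)) (at l) \<and>
       ((\<lambda>m'. uw_ell \<rho> (y t) m' l) has_real_derivative
          - (l * (1 + ln \<rho> * uw_A (y t) m powr l) / (m * ln m))) (at m)) \<and>
     (\<forall>t\<in>{1..int n}.
       (\<forall>c<1 + r + p + q. partial_differentiable (\<lambda>\<nu>'. eta g p q r y x \<nu>' t) \<nu> c) \<and>
       d_eta g p q r y x \<nu> 0 t =
         1 - (\<Sum>j\<in>{1..q}. par_theta p r \<nu> j * d_eta g p q r y x \<nu> 0 (t - int j)) \<and>
       (\<forall>l\<in>{1..r}. d_eta g p q r y x \<nu> l t =
         x t $ (l - 1) - (\<Sum>i\<in>{1..p}. par_phi r \<nu> i * cov r x (t - int i) $ (l - 1))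
         - (\<Sum>j\<in>{1..q}. par_theta p r \<nu> j * d_eta g p q r y x \<nu> l (t - int j))) \<and>
       (\<forall>k\<in>{1..p}. d_eta g p q r y x \<nu> (r + k) t =
         gobs g y (t - int k) - cov r x (t - int k) \<bullet> par_beta r \<nu>
         - (\<Sum>j\<in>{1..q}. par_theta p r \<nu> j * d_eta g p q r y x \<nu> (r + k) (t - int j))) \<and>
       (\<forall>s\<in>{1..q}. d_eta g p q r y x \<nu> (r + p + s) t =
         res g p q r y x \<nu> (t - int s)
         - (\<Sum>i\<in>{1..q}. par_theta p r \<nu> i * d_eta g p q r y x \<nu> (r + p + s) (t - int i)))) \<and>
     (\<forall>c<2 + r + p + q.
        partial_differentiable (loglik \<rho> g p q r n y x) (\<nu> @\<^sub>v vec 1 (\<lambda>_. lam)) c) \<and>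
     gradient (loglik \<rho> g p q r n y x) (\<nu> @\<^sub>v vec 1 (\<lambda>_. lam)) =
       ((D_mat g p q r n y x \<nu>)\<^sup>T * T_mat g p q r n y x \<nu> *\<^sub>v h1_vec \<rho> g p q r n y x \<nu> lam)
       @\<^sub>v vec 1 (\<lambda>_. ones_vec n \<bullet> h2_vec \<rho> g p q r n y x \<nu> lam)"
proof -
  interpret uwarma M \<rho> g p q r \<nu>\<^sub>0 lam\<^sub>0 Y X by (rule model)
  \<comment> \<open>The sample inherits the range (0,1) from the model at the outcome
    \<open>\<omega>\<close>; this makes A_t positive and the log-density differentiable.\<close>
  have y: "0 < y t \<and> y t < 1" if "t \<in> {1..int n}" for t
    using Y_range[of t \<omega>] realization that by simp
  note score = score[OF link parameter(1) assms(2,3) y parameter(2)]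
  show ?thesis
  proof (intro conjI ballI)
    fix t assume t: "t \<in> {1..int n}"
    then have t1: "t \<ge> 1" by simp
    note y = conjunct1[OF y[OF t]] conjunct2[OF y[OF t]]
    show "\<forall>l>0. ((\<lambda>l'. uw_ell \<rho> (y t) m l') has_real_derivative
          1 / l + (1 + uw_A (y t) m powr l * ln \<rho>) * ln (uw_A (y t) m)) (at l) \<and>
       ((\<lambda>m'. uw_ell \<rho> (y t) m' l) has_real_derivative
          - (l * (1 + ln \<rho> * uw_A (y t) m powr l) / (m * ln m))) (at m)"
      if "m \<in> {0<..<1}" for m
      using that y assms(2,3) by (simp add: uw_ell_derivative_lambda uw_ell_derivative_mu)
    show "\<forall>c<1 + r + p + q. partial_differentiable (\<lambda>\<nu>'. eta g p q r y x \<nu>' t) \<nu> c"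
      using partial_derivI(1)[where F = "\<lambda>\<nu>'. eta g p q r y x \<nu>' t",
          OF eta_derivative[OF link parameter(1) t1]] by blast
  qed (use d_eta_recursion[OF link parameter(1)] score in simp_all)
qed

end
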